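(* Let $R$ be an integral domain with $1$, let $d\ge 0$ and let $p(t)=a_0+a_1t+\cdots+a_dt^d\in R[t]$ be a polynomial of degree $d$ (so $a_d\neq 0$) with $a_0\neq 0$. For every integer $k\ge 0$ write $$\frac{(tp(t))^k}{1-t^{d+1}}=\sum_{i\ge 0} C_{i,k}\,t^i\in R[[t]].$$ Then for every integer $k\ge 0$ the sequence $\{C_{i,k}\}_{i\ge 0}$ is eventually periodic with period $d+1$, the periodicity starting at the $(1+(k-1)(d+1))$-st place; that is, for every integer $n\ge 0$, $$C_{1+(k-1)(d+1)+n,\,k}=C_{1+k(d+1)+n,\,k}.$$
   Context: $C_{i,k}$ is the entry in row $i$, column $k$ (rows and columns indexed from $0$) of the Riordan array $\bigl(1/(1-t^{d+1}),\,tp(t)\bigr)$, i.e. the infinite lower triangular matrix whose $k$-th column has generating function $(tp(t))^k/(1-t^{d+1})$. Coefficients of power series at negative indices are taken to be $0$ (relevant only for $k=0$). *)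

theory Defs
  imports "HOL-Computational_Algebra.Polynomial_FPS"
begin

text \<open>
  The Riordan array \<open>(g, f)\<close>, whose \<open>k\<close>-th column has generating function \<open>g * f ^ k\<close>.
  Rows are indexed by integers, with zero entries in negative rows.
\<close>

definition riordan_array :: "'a::comm_ring_1 fps \<Rightarrow> 'a fps \<Rightarrow> int \<Rightarrow> nat \<Rightarrow> 'a" where
  "riordan_array g f i k = (if i < 0 then 0 else fps_nth (g * f ^ k) (nat i))"

text \<open>
  \<open>1 / (1 - t ^ m)\<close> for \<open>m \<ge> 1\<close>. The division of \<open>fps\<close> needs an inverse operation on the
  coefficients; \<open>fps_right_inverse F y\<close> works over any ring, \<open>y\<close> being an inverse of the
  constant coefficient of \<open>F\<close>.
\<close>

definition inv_one_minus_X_power :: "nat \<Rightarrow> 'a::comm_ring_1 fps" where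
  "inv_one_minus_X_power m = fps_right_inverse (1 - fps_X ^ m) 1"

lemma inv_one_minus_X_power:
  assumes "m \<ge> 1"
  shows "(1 - fps_X ^ m) * inv_one_minus_X_power m = (1 :: 'a::comm_ring_1 fps)"
  unfolding inv_one_minus_X_power_def
  by (rule fps_right_inverse) (use assms in simp)

end

theory Submission
  imports Defs
begin

text \<open>
  Let \<open>m = d + 1\<close>. Multiplying the \<open>k\<close>-th column series by \<open>1 - t ^ m\<close> gives \<open>(t * p) ^ k\<close>, a
  polynomial of degree at most \<open>k * m\<close>. Beyond that degree the coefficients of the product,
  which are the differences \<open>C i k - C (i - m) k\<close>, vanish. The convention that entries in negative
  rows are zero makes this uniform in \<open>k\<close>, including \<open>k = 0\<close>.
\<close>

lemma riordan_array_diff_shift: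
  assumes "m \<ge> 1"
  shows "riordan_array (inv_one_minus_X_power m) f (int i) k
           - riordan_array (inv_one_minus_X_power m) f (int i - int m) k = fps_nth (f ^ k) i"
proof -
  define G where "G = inv_one_minus_X_power m * f ^ k"
  have "G - fps_X ^ m * G = ((1 - fps_X ^ m) * inv_one_minus_X_power m) * f ^ k"
    by (simp add: G_def algebra_simps)
  also have "\<dots> = f ^ k"
    by (simp only: inv_one_minus_X_power[OF assms] mult_1_left)
  finally have "fps_nth (f ^ k) i = fps_nth (G - fps_X ^ m * G) i"
    by simp
  also have "\<dots> = fps_nth G i - (if i < m then 0 else fps_nth G (i - m))"
    by (simp add: fps_X_power_mult_nth)
  \<comment> \<open>The case \<open>i < m\<close> is that of a negative row
    \<open>int i - int m\<close>, where the array is zero by convention.\<close>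
  finally show ?thesis
    by (auto simp: riordan_array_def G_def nat_diff_distrib')
qed

text \<open>The series is the polynomial \<open>pCons 0 p ^ k\<close>, and \<open>pCons 0 p\<close>
  has degree at most \<open>degree p + 1\<close>.\<close>

lemma fps_X_mult_fps_of_poly_power_nth_eq_0:
  fixes p :: "'a::comm_ring_1 poly"
  assumes "k * (degree p + 1) < i"
  shows "fps_nth ((fps_X * fps_of_poly p) ^ k) i = 0"
proof -
  have "degree (pCons 0 p ^ k) \<le> degree (pCons 0 p) * k"
    by (rule degree_power_le)
  also have "\<dots> \<le> (degree p + 1) * k"
    using degree_pCons_le[of 0 p] by (intro mult_right_mono) auto
  also have "\<dots> < i"
    using assms by (simp add: mult.commute)
  finally have "coeff (pCons 0 p ^ k) i = 0"
    by (rule coeff_eq_0)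
  moreover have "(fps_X * fps_of_poly p) ^ k = fps_of_poly (pCons 0 p ^ k)"
    by (simp add: fps_of_poly_power fps_of_poly_pCons mult.commute)
  ultimately show ?thesis
    by (simp only: fps_of_poly_nth)
qed

theorem theorem1:
  fixes p :: "'a::idom poly" and d :: nat and C :: "int \<Rightarrow> nat \<Rightarrow> 'a"
  assumes "degree p = d" and "coeff p d \<noteq> 0" and "coeff p 0 \<noteq> 0"
  defines "C \<equiv> riordan_array (inv_one_minus_X_power (d + 1)) (fps_X * fps_of_poly p)"
  shows "\<forall>(k::nat) (n::nat).
           C (1 + (int k - 1) * (int d + 1) + int n) k = C (1 + int k * (int d + 1) + int n) k"
proof (intro allI)
  fix k n :: nat
  \<comment> \<open>This is the larger of the two row indices; the summand 1 puts it just past the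
    degree bound \<open>k * (d + 1)\<close>, even for \<open>n = 0\<close>.\<close>
  define i where "i = 1 + k * (d + 1) + n"
  have "C (int i) k - C (int i - int (d + 1)) k = fps_nth ((fps_X * fps_of_poly p) ^ k) i"
    unfolding C_def by (rule riordan_array_diff_shift) simp
  also have "\<dots> = 0"
    by (rule fps_X_mult_fps_of_poly_power_nth_eq_0) (simp add: i_def assms(1))
  finally have "C (int i - int (d + 1)) k = C (int i) k"
    by simp
  moreover have "int i = 1 + int k * (int d + 1) + int n"
    by (simp add: i_def algebra_simps)
  moreover have "int i - int (d + 1) = 1 + (int k - 1) * (int d + 1) + int n"
    by (simp add: i_def algebra_simps)
  ultimately show "C (1 + (int k - 1) * (int d + 1) + int n) k = C (1 + int k * (int d + 1) + int n) k"
    by (simp only:)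
qed

end
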